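(* Let $d$ be a $g$-quasi metric on a nonempty set $X$, and let $\mu(d)$ be the generalized topology induced by $d$. Then $(X,\mu(d))$ is $\mu$-$T_1$ (with $\mu=\mu(d)$).
   Context: A $g$-quasi metric on a nonempty set $X$ is a mapping $d:X\times X\to\mathbb R$ for which there exists $r\ge 0$ (called the index of $d$) such that (a) for all $x,y\in X$, $d(x,y)\ge r$, and $d(x,y)=r\iff x=y$; (b) for all $x,y,z\in X$, $d(x,y)\le d(x,z)+d(z,y)$. (Symmetry is not assumed.) For $x\in X$ and $p>0$ let $B_d(x,p)=\{y\in X: d(x,y)<p\}$. The generalized topology $\mu(d)$ induced by $d$ is the collection of all unions of members of $\{B_d(x,p):x\in X,\ p>0\}\cup\{\emptyset\}$; it contains $\emptyset$ and $X$ and is closed under arbitrary unions, i.e. it is a strong generalized topology. A strong generalized topological space $(X,\mu)$ (a collection $\mu$ of subsets of $X$ containing $\emptyset$ and $X$ and closed under arbitrary unions) is called $\mu$-$T_1$ if for all $x,y\in X$ with $x\ne y$ there exist $B_1,B_2\in\mu$ such that $B_1$ contains $x$ but not $y$ and $B_2$ contains $y$ but not $x$. *)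

theory Defs
  imports Complex_Main
begin

text \<open>
  All notions are relative to a carrier set \<open>X\<close>. A map $X \times X \to R$ is a curried
  function on the whole type, of which only the values on \<open>X\<close> are ever used.
\<close>

definition has_index :: "'a set \<Rightarrow> ('a \<Rightarrow> 'a \<Rightarrow> real) \<Rightarrow> real \<Rightarrow> bool" where
  "has_index X d r \<longleftrightarrow>
     0 \<le> r \<and> (\<forall>x\<in>X. \<forall>y\<in>X. r \<le> d x y \<and> (d x y = r \<longleftrightarrow> x = y))"

definition g_quasi_metric :: "'a set \<Rightarrow> ('a \<Rightarrow> 'a \<Rightarrow> real) \<Rightarrow> bool" where
  "g_quasi_metric X d \<longleftrightarrow>
     X \<noteq> {} \<and> (\<exists>r. has_index X d r) \<and>
     (\<forall>x\<in>X. \<forall>y\<in>X. \<forall>z\<in>X. d x y \<le> d x z + d z y)"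

text \<open>The radius is not required to exceed the index, so a ball may be empty.\<close>

definition g_ball :: "'a set \<Rightarrow> ('a \<Rightarrow> 'a \<Rightarrow> real) \<Rightarrow> 'a \<Rightarrow> real \<Rightarrow> 'a set" where
  "g_ball X d x p = {y \<in> X. d x y < p}"

definition induced_gt :: "'a set \<Rightarrow> ('a \<Rightarrow> 'a \<Rightarrow> real) \<Rightarrow> 'a set set" where
  "induced_gt X d =
     {\<Union>\<B> | \<B>. \<B> \<subseteq> {g_ball X d x p | x p. x \<in> X \<and> 0 < p} \<union> {{}}}"

definition strong_gt :: "'a set \<Rightarrow> 'a set set \<Rightarrow> bool" where
  "strong_gt X \<mu> \<longleftrightarrow>
     \<mu> \<subseteq> Pow X \<and> {} \<in> \<mu> \<and> X \<in> \<mu> \<and> (\<forall>\<U>. \<U> \<subseteq> \<mu> \<longrightarrow> \<Union>\<U> \<in> \<mu>)"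

text \<open>
  The separation property is only defined for strong generalized topological spaces,
  so being one is part of the predicate.
\<close>

definition mu_T1 :: "'a set \<Rightarrow> 'a set set \<Rightarrow> bool" where
  "mu_T1 X \<mu> \<longleftrightarrow>
     strong_gt X \<mu> \<and>
     (\<forall>x\<in>X. \<forall>y\<in>X. x \<noteq> y \<longrightarrow>
        (\<exists>B1\<in>\<mu>. \<exists>B2\<in>\<mu>. x \<in> B1 \<and> y \<notin> B1 \<and> y \<in> B2 \<and> x \<notin> B2))"

end

theory Submission
  imports Defs
begin

text \<open>
  For distinct points \<open>x\<close> and \<open>y\<close> the number \<open>d x y\<close> exceeds the index \<open>r = d x x\<close>. The ball
  around \<open>x\<close> of radius \<open>d x y\<close> therefore contains its centre, and since balls are defined by a
  strict inequality it misses \<open>y\<close>. Its radius is positive because \<open>r \<ge> 0\<close>, so it is a member of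
  the induced generalized topology. The situation is not symmetric, as \<open>d x y\<close> and \<open>d y x\<close> may
  differ, but exchanging the roles of the points separates \<open>y\<close> from \<open>x\<close> by a ball around \<open>y\<close>.
  That the induced family is a strong generalized topology at all comes down to two points: unions
  of unions of balls are unions of balls, and every point lies in a ball around itself, provided
  the radius is chosen larger than \<open>r\<close>.
\<close>

lemma g_ball_in_induced_gt:
  assumes "x \<in> X" "0 < p"
  shows "g_ball X d x p \<in> induced_gt X d"
  unfolding induced_gt_def using assms by (intro CollectI exI[of _ "{g_ball X d x p}"]) auto

text \<open>
  Choosing a family of generators for each member would need a choice function; taking all
  generators that lie inside some member of \<open>\<U>\<close> avoids this and yields the same union.
\<close>

lemma unions_of_subfamilies_closed:
  assumes "\<U> \<subseteq> {\<Union>\<B> | \<B>. \<B> \<subseteq> \<G>}"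
  shows "\<Union>\<U> \<in> {\<Union>\<B> | \<B>. \<B> \<subseteq> \<G>}"
proof -
  let ?\<C> = "{B \<in> \<G>. \<exists>U\<in>\<U>. B \<subseteq> U}"
  have "\<Union>\<U> \<subseteq> \<Union>?\<C>"
  proof
    fix z assume "z \<in> \<Union>\<U>"
    then obtain U where U: "U \<in> \<U>" "z \<in> U" by blast
    then obtain \<B> where "U = \<Union>\<B>" "\<B> \<subseteq> \<G>" using assms by blast
    with U show "z \<in> \<Union>?\<C>" by blast
  qed
  moreover have "\<Union>?\<C> \<subseteq> \<Union>\<U>" by blast
  ultimately have "\<Union>\<U> = \<Union>?\<C>" by (rule subset_antisym)
  then show ?thesis by blast
qed

lemma Union_in_induced_gt:
  assumes "\<U> \<subseteq> induced_gt X d"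
  shows "\<Union>\<U> \<in> induced_gt X d"
  using assms unfolding induced_gt_def by (rule unions_of_subfamilies_closed)

text \<open>
  Nonnegativity on the diagonal serves only to make the radius \<open>d x x + 1\<close> of the balls that
  cover the carrier positive; the summand \<open>1\<close> puts each centre into its ball.
\<close>

lemma strong_gt_induced_gt:
  assumes "\<And>x. x \<in> X \<Longrightarrow> 0 \<le> d x x"
  shows "strong_gt X (induced_gt X d)"
proof -
  have "induced_gt X d \<subseteq> Pow X"
    unfolding induced_gt_def g_ball_def by blast
  moreover have "{} \<in> induced_gt X d"
    using Union_in_induced_gt[of "{}"] by simp
  moreover have "X \<in> induced_gt X d"
  proof -
    have "(\<Union>x\<in>X. g_ball X d x (d x x + 1)) \<in> induced_gt X d"
    proof (rule Union_in_induced_gt, rule image_subsetI)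
      fix x assume "x \<in> X"
      then show "g_ball X d x (d x x + 1) \<in> induced_gt X d"
        using assms[of x] by (intro g_ball_in_induced_gt) auto
    qed
    moreover have "(\<Union>x\<in>X. g_ball X d x (d x x + 1)) = X"
      by (auto simp: g_ball_def)
    ultimately show ?thesis by simp
  qed
  ultimately show ?thesis
    using Union_in_induced_gt unfolding strong_gt_def by blast
qed

lemma ball_separates_centre:
  assumes "has_index X d r" "x \<in> X" "y \<in> X" "x \<noteq> y"
  shows "g_ball X d x (d x y) \<in> induced_gt X d"
    and "x \<in> g_ball X d x (d x y)"
    and "y \<notin> g_ball X d x (d x y)"
proof -
  have r: "0 \<le> r" "d x x = r" "r < d x y"
    using assms unfolding has_index_def by (auto simp: order_less_le)
  from r assms(2) show "g_ball X d x (d x y) \<in> induced_gt X d"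
    by (intro g_ball_in_induced_gt) auto
  from r assms(2) show "x \<in> g_ball X d x (d x y)"
    by (simp add: g_ball_def)
  show "y \<notin> g_ball X d x (d x y)"
    by (simp add: g_ball_def)
qed

theorem theorem3p10:
  fixes X :: "'a set" and d :: "'a \<Rightarrow> 'a \<Rightarrow> real"
  assumes "g_quasi_metric X d"
  shows "mu_T1 X (induced_gt X d)"
proof -
  obtain r where r: "has_index X d r"
    using assms unfolding g_quasi_metric_def by blast
  then have "0 \<le> d x x" if "x \<in> X" for x
    using that unfolding has_index_def by auto
  then have "strong_gt X (induced_gt X d)"
    by (rule strong_gt_induced_gt)
  moreover have "\<exists>B1\<in>induced_gt X d. \<exists>B2\<in>induced_gt X d.
      x \<in> B1 \<and> y \<notin> B1 \<and> y \<in> B2 \<and> x \<notin> B2"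
    if "x \<in> X" "y \<in> X" "x \<noteq> y" for x y
    using ball_separates_centre[OF r that] ball_separates_centre[OF r that(2,1)] that(3)
    by blast
  ultimately show ?thesis
    unfolding mu_T1_def by blast
qed

end
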